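(* Let $\mu : \bar{\mathbb{R}}^m \to \bar{\mathbb{R}}$ be any function satisfying: (1) if $w \in \bar{\mathbb{R}}^m_+$ then $\mu(w) \ge 0$; (2) $w \in \bar{\mathbb{R}}^m_+$ and $\mu(w) = 0$ if and only if $w_i = 0$ for all $i \in I$. Consider the optimization problem $$ \delta := \inf_{x,y_1,\dots,y_m} \; \mu\bigl(g_1(x,y_1) - g_1^*(x), \dots, g_m(x,y_m) - g_m^*(x)\bigr) \quad \text{s.t.} \quad (x,y_1,\dots,y_m) \in G, \quad y_i \in Y_i \;\; \forall i \in I . $$ Then any $(x^*,y_1^*,\dots,y_m^* )$ is a solution of this problem with $\delta = 0$ if and only if it is a constrained pure Nash equilibrium of the game $\mathcal{G}(G, (g_i,Y_i)_{i\in I})$.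
   Context: Let $I = \{1,\dots,m\}$ index the players. For each $i \in I$ let $Y_i \subset \mathbb{R}^{n_i}$ and $g_i : \mathbb{R}^{n_0} \times Y_i \to \mathbb{R}$; no convexity, continuity or compactness is assumed. Let $G \subset \mathbb{R}^{n_0} \times \mathbb{R}^{n_1} \times \dots \times \mathbb{R}^{n_m}$ be a global (side) constraint set. For $x \in \mathbb{R}^{n_0}$, player $i$ solves the problem of minimizing $g_i(x,y_i)$ over $y_i \in Y_i$, with solution set $S_i(x) = \arg\min_{y_i} \{ g_i(x,y_i) : y_i \in Y_i\}$ (possibly empty) and optimal value $g_i^*(x) = \inf_{y_i} \{ g_i(x,y_i) : y_i \in Y_i\}$, where $g_i^*(x) = -\infty$ if the problem is unbounded below and $g_i^*(x)=+\infty$ if $Y_i$ is empty. This game is denoted $\mathcal{G}(G, (g_i,Y_i)_{i\in I})$. A point $(x^*,y_1^*,\dots,y_m^* )$ is a constrained pure Nash equilibrium of $\mathcal{G}(G, (g_i,Y_i)_{i\in I})$ if $(x^*,y_1^*,\dots,y_m^* ) \in G$ and $y_i^* \in S_i(x^* )$ for each $i \in I$. Notation: $\bar{\mathbb{R}} = \mathbb{R} \cup \{-\infty,+\infty\}$ with the usual order, $\bar{\mathbb{R}}^m$ is its $m$-fold Cartesian product, and $\bar{\mathbb{R}}^m_+ = \{ w \in \bar{\mathbb{R}}^m : w_i \ge 0 \ \forall i \in I\}$. A "solution" of a minimization problem is a feasible point whose objective value equals the infimum (the infimum over the empty set is $+\infty$). *)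

theory Defs
  imports
    "HOL-Library.Extended_Real"
    "HOL-Library.FuncSet"
    "Jordan_Normal_Form.Matrix"
begin

text \<open>
  Conventions. The players are the elements of \<open>{1..m}\<close>, and \<open>n 0, n 1, \<dots>, n m\<close> are the
  dimensions of the spaces involved, which may differ from player to player; \<open>carrier_vec k\<close>, the
  set of real vectors of length \<open>k\<close>, is \<open>\<real>\<close> to the power \<open>k\<close>.
  A point \<open>(x, y\<^sub>1, \<dots>, y\<^sub>m)\<close> is a pair \<open>(x, y)\<close> with \<open>y\<close> an extensional function on
  \<open>{1..m}\<close>, so that distinct pairs are distinct tuples. The function \<open>g i\<close> is total, but only its
  values on \<open>carrier_vec (n 0) \<times> Y i\<close> are relevant.
\<close>

definition point_space :: "nat \<Rightarrow> (nat \<Rightarrow> nat) \<Rightarrow> (real vec \<times> (nat \<Rightarrow> real vec)) set" where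
  "point_space m n = carrier_vec (n 0) \<times> (\<Pi>\<^sub>E i\<in>{1..m}. carrier_vec (n i))"

text \<open>
  The infimum is taken in \<open>ereal\<close>: it is \<open>\<infinity>\<close> for an empty feasible set and \<open>-\<infinity>\<close> if the
  objective is unbounded below.
\<close>

definition optimal_value :: "('a \<Rightarrow> ereal) \<Rightarrow> 'a set \<Rightarrow> ereal" where
  "optimal_value f X = (INF z\<in>X. f z)"

definition solutions :: "('a \<Rightarrow> ereal) \<Rightarrow> 'a set \<Rightarrow> 'a set" where
  "solutions f X = {z \<in> X. f z = optimal_value f X}"

definition best_value ::
    "(nat \<Rightarrow> real vec \<Rightarrow> real vec \<Rightarrow> real) \<Rightarrow> (nat \<Rightarrow> real vec set) \<Rightarrow> nat \<Rightarrow> real vec \<Rightarrow> ereal" where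
  "best_value g Y i x = optimal_value (\<lambda>v. ereal (g i x v)) (Y i)"

definition best_responses ::
    "(nat \<Rightarrow> real vec \<Rightarrow> real vec \<Rightarrow> real) \<Rightarrow> (nat \<Rightarrow> real vec set) \<Rightarrow> nat \<Rightarrow> real vec \<Rightarrow> real vec set" where
  "best_responses g Y i x = solutions (\<lambda>v. ereal (g i x v)) (Y i)"

definition constrained_pure_nash ::
    "nat \<Rightarrow> (real vec \<times> (nat \<Rightarrow> real vec)) set \<Rightarrow> (nat \<Rightarrow> real vec \<Rightarrow> real vec \<Rightarrow> real)
      \<Rightarrow> (nat \<Rightarrow> real vec set) \<Rightarrow> real vec \<times> (nat \<Rightarrow> real vec) \<Rightarrow> bool" where
  "constrained_pure_nash m G g Y = (\<lambda>(x, y).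
     (x, y) \<in> G \<and> (\<forall>i\<in>{1..m}. y i \<in> best_responses g Y i x))"

definition ereal_space :: "nat \<Rightarrow> (nat \<Rightarrow> ereal) set" where
  "ereal_space m = {1..m} \<rightarrow>\<^sub>E UNIV"

definition ereal_space_nonneg :: "nat \<Rightarrow> (nat \<Rightarrow> ereal) set" where
  "ereal_space_nonneg m = {w \<in> ereal_space m. \<forall>i\<in>{1..m}. 0 \<le> w i}"

text \<open>
  At feasible points every difference below is of the form real minus real or real minus \<open>-\<infinity>\<close>
  (which is \<open>\<infinity>\<close>): if \<open>best_value g Y i x = \<infinity>\<close> then \<open>Y i\<close> is empty and no point is feasible.
\<close>

definition gap_objective ::
    "nat \<Rightarrow> ((nat \<Rightarrow> ereal) \<Rightarrow> ereal) \<Rightarrow> (nat \<Rightarrow> real vec \<Rightarrow> real vec \<Rightarrow> real)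
      \<Rightarrow> (nat \<Rightarrow> real vec set) \<Rightarrow> real vec \<times> (nat \<Rightarrow> real vec) \<Rightarrow> ereal" where
  "gap_objective m \<mu> g Y = (\<lambda>(x, y).
     \<mu> (\<lambda>i\<in>{1..m}. ereal (g i x (y i)) - best_value g Y i x))"

definition gap_feasible ::
    "nat \<Rightarrow> (real vec \<times> (nat \<Rightarrow> real vec)) set \<Rightarrow> (nat \<Rightarrow> real vec set)
      \<Rightarrow> (real vec \<times> (nat \<Rightarrow> real vec)) set" where
  "gap_feasible m G Y = {(x, y) \<in> G. \<forall>i\<in>{1..m}. y i \<in> Y i}"

end

theory Submission
  imports Defs
begin

text \<open>
  At a feasible point each entry of the gap vector \<open>g\<^sub>i (x, y\<^sub>i) - g\<^sub>i\<^sup>* (x)\<close> is nonnegative, because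
  \<open>y\<^sub>i\<close> competes in the infimum that defines \<open>g\<^sub>i\<^sup>* (x)\<close>, and the entry vanishes exactly when
  \<open>y\<^sub>i\<close> is a best response. Hence \<open>\<mu>\<close> turns the game into a minimization problem whose objective is
  nonnegative on the feasible set (\<open>gap_objective_nonneg\<close>) and is zero exactly at the equilibria
  (\<open>gap_objective_eq_0_iff\<close>). For such an objective, being a minimizer with optimal value \<open>0\<close> is the
  same as being a feasible zero (\<open>solution_with_value_0_iff\<close>), since \<open>0\<close> is already a lower bound.
\<close>

text \<open>
  A feasible zero certifies the optimal value: it bounds the infimum from above by \<open>0\<close>, which
  nonnegativity makes the greatest lower bound.
\<close>

lemma solution_with_value_0_iff:
  assumes nonneg: "\<And>z. z \<in> X \<Longrightarrow> 0 \<le> f z"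
  shows "z \<in> solutions f X \<and> optimal_value f X = 0 \<longleftrightarrow> z \<in> X \<and> f z = 0"
proof -
  have "optimal_value f X = 0" if "z \<in> X" "f z = 0"
  proof (rule antisym)
    show "optimal_value f X \<le> 0"
      unfolding optimal_value_def using that by (metis INF_lower)
    show "0 \<le> optimal_value f X"
      unfolding optimal_value_def by (rule INF_greatest) (rule nonneg)
  qed
  then show ?thesis
    by (auto simp: solutions_def)
qed

lemma best_value_le:
  assumes "v \<in> Y i"
  shows "best_value g Y i x \<le> ereal (g i x v)"
  unfolding best_value_def optimal_value_def using assms by (rule INF_lower)

lemma gap_nonneg:
  assumes "v \<in> Y i"
  shows "0 \<le> ereal (g i x v) - best_value g Y i x"
  using best_value_le[of v Y i g x] assms by (simp add: ereal_diff_positive)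

text \<open>
  Subtraction cancels here because the minuend is finite: an infinite best value gives an infinite
  gap, so a vanishing gap also shows that player \<open>i\<close>'s problem is bounded below and attained at \<open>v\<close>.
\<close>

lemma gap_eq_0_iff:
  assumes "v \<in> Y i"
  shows "ereal (g i x v) - best_value g Y i x = 0 \<longleftrightarrow> v \<in> best_responses g Y i x"
proof -
  have "ereal (g i x v) - best_value g Y i x = 0 \<longleftrightarrow> ereal (g i x v) = best_value g Y i x"
    by (cases "best_value g Y i x") auto
  then show ?thesis
    using assms by (simp add: best_responses_def solutions_def best_value_def)
qed

lemma gap_vector_nonneg:
  assumes "(x, y) \<in> gap_feasible m G Y"
  shows "(\<lambda>i\<in>{1..m}. ereal (g i x (y i)) - best_value g Y i x) \<in> ereal_space_nonneg m"
  using assms gap_nonneg by (auto simp: gap_feasible_def ereal_space_nonneg_def ereal_space_def)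

lemma gap_objective_nonneg:
  assumes nonneg: "\<And>w. w \<in> ereal_space_nonneg m \<Longrightarrow> 0 \<le> \<mu> w"
    and "z \<in> gap_feasible m G Y"
  shows "0 \<le> gap_objective m \<mu> g Y z"
proof (cases z)
  case (Pair x y)
  have "0 \<le> \<mu> (\<lambda>i\<in>{1..m}. ereal (g i x (y i)) - best_value g Y i x)"
    using assms(2) unfolding Pair by (intro nonneg gap_vector_nonneg)
  then show ?thesis
    by (simp add: Pair gap_objective_def)
qed

text \<open>
  The gap vector is already known to be nonnegative, so a zero of \<open>\<mu>\<close> at it forces every gap to
  vanish; off the nonnegative cone \<open>\<mu>\<close> may have other zeros.
\<close>

lemma gap_objective_eq_0_iff:
  assumes definite: "\<And>w. w \<in> ereal_space m \<Longrightarrow>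
      (w \<in> ereal_space_nonneg m \<and> \<mu> w = 0) \<longleftrightarrow> (\<forall>i\<in>{1..m}. w i = 0)"
    and feasible: "(x, y) \<in> gap_feasible m G Y"
  shows "gap_objective m \<mu> g Y (x, y) = 0 \<longleftrightarrow> (\<forall>i\<in>{1..m}. y i \<in> best_responses g Y i x)"
proof -
  define w where "w = (\<lambda>i\<in>{1..m}. ereal (g i x (y i)) - best_value g Y i x)"
  have w_nonneg: "w \<in> ereal_space_nonneg m"
    unfolding w_def using feasible by (rule gap_vector_nonneg)
  then have w_space: "w \<in> ereal_space m"
    by (simp add: ereal_space_nonneg_def)
  have "gap_objective m \<mu> g Y (x, y) = 0 \<longleftrightarrow> \<mu> w = 0"
    by (simp add: gap_objective_def w_def)
  also have "\<dots> \<longleftrightarrow> (\<forall>i\<in>{1..m}. w i = 0)"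
    using definite[OF w_space] w_nonneg by blast
  also have "\<dots> \<longleftrightarrow> (\<forall>i\<in>{1..m}. y i \<in> best_responses g Y i x)"
    using feasible by (intro ball_cong) (auto simp: w_def gap_feasible_def gap_eq_0_iff)
  finally show ?thesis .
qed

lemma constrained_pure_nash_iff_feasible:
  "constrained_pure_nash m G g Y (x, y) \<longleftrightarrow>
     (x, y) \<in> gap_feasible m G Y \<and> (\<forall>i\<in>{1..m}. y i \<in> best_responses g Y i x)"
  by (auto simp: constrained_pure_nash_def gap_feasible_def best_responses_def solutions_def)

theorem proposition1:
  fixes m :: nat
    and n :: "nat \<Rightarrow> nat"
    and Y :: "nat \<Rightarrow> real vec set"
    and g :: "nat \<Rightarrow> real vec \<Rightarrow> real vec \<Rightarrow> real"
    and G :: "(real vec \<times> (nat \<Rightarrow> real vec)) set"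
    and \<mu> :: "(nat \<Rightarrow> ereal) \<Rightarrow> ereal"
    and x :: "real vec"
    and y :: "nat \<Rightarrow> real vec"
  assumes "\<And>i. i \<in> {1..m} \<Longrightarrow> Y i \<subseteq> carrier_vec (n i)"
    and "G \<subseteq> point_space m n"
    and "\<And>w. w \<in> ereal_space_nonneg m \<Longrightarrow> 0 \<le> \<mu> w"
    and "\<And>w. w \<in> ereal_space m \<Longrightarrow>
           (w \<in> ereal_space_nonneg m \<and> \<mu> w = 0) \<longleftrightarrow> (\<forall>i\<in>{1..m}. w i = 0)"
  shows "((x, y) \<in> solutions (gap_objective m \<mu> g Y) (gap_feasible m G Y)
            \<and> optimal_value (gap_objective m \<mu> g Y) (gap_feasible m G Y) = 0)
         \<longleftrightarrow> constrained_pure_nash m G g Y (x, y)"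
proof -
  have "(x, y) \<in> solutions (gap_objective m \<mu> g Y) (gap_feasible m G Y)
          \<and> optimal_value (gap_objective m \<mu> g Y) (gap_feasible m G Y) = 0
        \<longleftrightarrow> (x, y) \<in> gap_feasible m G Y \<and> gap_objective m \<mu> g Y (x, y) = 0"
    by (intro solution_with_value_0_iff gap_objective_nonneg assms(3))
  also have "\<dots> \<longleftrightarrow> (x, y) \<in> gap_feasible m G Y \<and> (\<forall>i\<in>{1..m}. y i \<in> best_responses g Y i x)"
    by (intro conj_cong refl gap_objective_eq_0_iff assms(4))
  also have "\<dots> \<longleftrightarrow> constrained_pure_nash m G g Y (x, y)"
    by (rule constrained_pure_nash_iff_feasible[symmetric])
  finally show ?thesis .
qed

end
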